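(* Let $\bar A$ and $\bar B$ be linear quantum stochastic systems with $n_A$ and $n_B$ modes, $m_A$ and $m_B$ inputs/outputs, and parameters $(\bar R_A,\bar C_A,\bar D_A)$ and $(\bar R_B,\bar C_B,\bar D_B)$, respectively. Here $\bar R_A\in\mathbb{R}^{2n_A\times 2n_A}$ and $\bar R_B\in\mathbb{R}^{2n_B\times 2n_B}$ are symmetric, $\bar C_A\in\mathbb{R}^{2m_A\times 2n_A}$, $\bar C_B\in\mathbb{R}^{2m_B\times 2n_B}$, and $\bar D_A\in\mathbb{R}^{2m_A\times 2m_A}$, $\bar D_B\in\mathbb{R}^{2m_B\times 2m_B}$ are symplectic. Let $\bar R_{AB}\in\mathbb{R}^{2n_A\times 2n_B}$ be arbitrary. Then the direct-interaction model of $\bar A$ and $\bar B$ with interaction Hamiltonian $\bar x_A^{\top}\bar R_{AB}\bar x_B$ can be realized by the field-mediated model of the bidirectional (feedback) interaction between two linear quantum stochastic systems $A$ and $B$ (both models, and the meaning of "realized", are given in the context). More precisely: (i) For every integer $m\ge \lceil \tfrac12\operatorname{Rank}(\bar R_{AB})\rceil$ there exist real matrices $C_A\in\mathbb{R}^{2m\times 2n_A}$, $C_B\in\mathbb{R}^{2m\times 2n_B}$, and $X\in\mathbb{R}^{2m\times 2m}$ with $X^{\sharp}=-X$ and $X+I$ invertible, such that $$\bar R_{AB}=\tfrac12\,\mathbb{J}\,C_A^{\sharp}(X+I)C_B .$$ (ii) For any such $m$, $C_A$, $C_B$, $X$, the direct-interaction model with parameters $(\bar R_A,\bar C_A,\bar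 D_A)$, $(\bar R_B,\bar C_B,\bar D_B)$, $\bar R_{AB}$ is realized by the field-mediated model with $m$ interconnection channels, with the same $\bar C_A,\bar D_A,\bar C_B,\bar D_B$, with coupling matrices $C_A$, $C_B$ for the interconnection channels, and with $$R_A=\bar R_A-\tfrac12\mathbb{J}\,(C_A^{\sharp}XC_A),\qquad R_B=\bar R_B-\tfrac12\mathbb{J}\,(C_B^{\sharp}XC_B),\qquad \Sigma=(X-I)(X+I)^{-1}.$$
   Context: Notation. $\mathbb{J}_{2k}=\begin{pmatrix}0&I_k\\-I_k&0\end{pmatrix}$, written $\mathbb{J}$ when the size is clear from the context. For a $2r\times 2s$ matrix $M$, its $\sharp$-adjoint is the $2s\times 2r$ matrix $M^{\sharp}=-\mathbb{J}_{2s}M^{\dagger}\mathbb{J}_{2r}$, where $M^{\dagger}$ is the conjugate transpose ($M^{\dagger}=M^{\top}$ for real $M$). A $2k\times 2k$ matrix $T$ is symplectic if $TT^{\sharp}=T^{\sharp}T=I_{2k}$, equivalently $T\mathbb{J}T^{\dagger}=T^{\dagger}\mathbb{J}T=\mathbb{J}$. $\lceil x\rceil$ is the smallest integer $\ge x$. Linear quantum stochastic system (LQSS). An LQSS with $n$ modes and $k$ inputs/outputs has a state $x$, a $2n$-vector of self-adjoint operators (positions, then momenta) satisfying $xx^{\top}-(xx^{\top})^{\top}=\imath\mathbb{J}_{2n}$. It also has $2k$-vectors of input and output field quadratures $\mathcal U,\mathcal Y$. Its parameters are a real symmetric $2n\times 2n$ Hamiltonian matrix $R$, a real $2k\times 2n$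 coupling matrix $C$, and a real symplectic $2k\times 2k$ matrix $D$. Its dynamics are the quantum stochastic differential equations $$dx=(\mathbb{J}R-\tfrac12C^{\sharp}C)x\,dt-C^{\sharp}D\,d\mathcal U,\qquad d\mathcal Y=Cx\,dt+D\,d\mathcal U.$$ Direct-interaction (Hamiltonian) model, with parameters $(\bar R_A,\bar C_A,\bar D_A)$, $(\bar R_B,\bar C_B,\bar D_B)$, $\bar R_{AB}$: $$d\bar x_A=[\mathbb{J}\bar R_A-\tfrac12\bar C_A^{\sharp}\bar C_A]\bar x_A\,dt+\mathbb{J}\bar R_{AB}\bar x_B\,dt-\bar C_A^{\sharp}\bar D_A\,d\bar{\mathcal U}_A,$$ $$d\bar x_B=[\mathbb{J}\bar R_B-\tfrac12\bar C_B^{\sharp}\bar C_B]\bar x_B\,dt+\mathbb{J}\bar R_{AB}^{\top}\bar x_A\,dt-\bar C_B^{\sharp}\bar D_B\,d\bar{\mathcal U}_B,$$ $$d\bar{\mathcal Y}_A=\bar C_A\bar x_A\,dt+\bar D_A\,d\bar{\mathcal U}_A,\qquad d\bar{\mathcal Y}_B=\bar C_B\bar x_B\,dt+\bar D_B\,d\bar{\mathcal U}_B.$$ Field-mediated (feedback) model with $m$ interconnection channels. Its parameters are real symmetric matrices $R_A$ ($2n_A\times 2n_A$) and $R_B$ ($2n_B\times 2n_B$); real matrices $\bar C_A$ ($2m_A\times 2n_A$), $\bar C_B$ ($2m_B\times 2n_B$), $C_A$ ($2m\times 2n_A$), $C_B$ ($2m\times 2n_B$); and real symplectic matrices $\bar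 D_A$ ($2m_A\times 2m_A$), $\bar D_B$ ($2m_B\times 2m_B$), $\Sigma$ ($2m\times 2m$). System $A$ has external inputs/outputs $(\bar{\mathcal U}_A,\bar{\mathcal Y}_A)$ and interconnection inputs/outputs $(\mathcal U_A,\mathcal Y_A)$ of dimension $2m$, and similarly for $B$: $$dx_A=[\mathbb{J}R_A-\tfrac12\bar C_A^{\sharp}\bar C_A-\tfrac12C_A^{\sharp}C_A]x_A\,dt-\bar C_A^{\sharp}\bar D_A\,d\bar{\mathcal U}_A-C_A^{\sharp}\,d\mathcal U_A,$$ $$dx_B=[\mathbb{J}R_B-\tfrac12\bar C_B^{\sharp}\bar C_B-\tfrac12C_B^{\sharp}C_B]x_B\,dt-\bar C_B^{\sharp}\bar D_B\,d\bar{\mathcal U}_B-C_B^{\sharp}\,d\mathcal U_B,$$ $$d\bar{\mathcal Y}_A=\bar C_Ax_A\,dt+\bar D_A\,d\bar{\mathcal U}_A,\qquad d\bar{\mathcal Y}_B=\bar C_Bx_B\,dt+\bar D_B\,d\bar{\mathcal U}_B,$$ $$d\mathcal Y_A=C_Ax_A\,dt+d\mathcal U_A,\qquad d\mathcal Y_B=C_Bx_B\,dt+d\mathcal U_B,$$ with feedback interconnection conditions $\mathcal U_B=\Sigma\mathcal Y_A$ and $\mathcal U_A=\mathcal Y_B$. Meaning of "realized". The direct-interaction model is realized by a field-mediated model if the following hold. The parameters of the latter are admissible ($R_A,R_B$ real symmetric, $\Sigma$ real symplectic). The linear equations for $d\mathcal U_A,d\mathcal U_B$ resulting from the interconnection conditions,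 namely $d\mathcal U_B=\Sigma C_Ax_A\,dt+\Sigma\,d\mathcal U_A$ and $d\mathcal U_A=C_Bx_B\,dt+d\mathcal U_B$, have a unique solution. Substituting this solution into the equations for $dx_A,dx_B$ turns the equations for $(x_A,x_B,\bar{\mathcal Y}_A,\bar{\mathcal Y}_B)$ into exactly the equations of the direct-interaction model, with $x_A,x_B$ in the roles of $\bar x_A,\bar x_B$. This is an identity between the coefficient matrices of $x_A\,dt$, $x_B\,dt$, $d\bar{\mathcal U}_A$, $d\bar{\mathcal U}_B$. *)

theory Defs
  imports
    "Jordan_Normal_Form.DL_Rank"
    "Jordan_Normal_Form.Gauss_Jordan_Elimination"
begin

definition JJ :: "nat \<Rightarrow> real mat" where
  "JJ k = four_block_mat (0\<^sub>m k k) (1\<^sub>m k) (- 1\<^sub>m k) (0\<^sub>m k k)"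

text \<open>Meaningful for matrices with an even number of rows and of columns. All matrices here are
  real, so the conjugate transpose is the transpose.\<close>

definition sharp :: "real mat \<Rightarrow> real mat" where
  "sharp M = - (JJ (dim_col M div 2) * transpose_mat M * JJ (dim_row M div 2))"

definition symplectic :: "nat \<Rightarrow> real mat \<Rightarrow> bool" where
  "symplectic k T \<longleftrightarrow> T \<in> carrier_mat (2 * k) (2 * k)
     \<and> T * sharp T = 1\<^sub>m (2 * k) \<and> sharp T * T = 1\<^sub>m (2 * k)"

definition symmetric :: "nat \<Rightarrow> real mat \<Rightarrow> bool" where
  "symmetric n R \<longleftrightarrow> R \<in> carrier_mat n n \<and> transpose_mat R = R"

definition mat_inv :: "real mat \<Rightarrow> real mat" where
  "mat_inv M = the (mat_inverse M)"

record lqss =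
  modes :: nat
  chans :: nat
  ham :: "real mat"
  coup :: "real mat"
  feed :: "real mat"

definition valid_lqss :: "lqss \<Rightarrow> bool" where
  "valid_lqss S \<longleftrightarrow> symmetric (2 * modes S) (ham S)
     \<and> coup S \<in> carrier_mat (2 * chans S) (2 * modes S)
     \<and> symplectic (chans S) (feed S)"

record direct_model =
  dirA :: lqss
  dirB :: lqss
  inter :: "real mat"

text \<open>In \<open>fldA\<close> and \<open>fldB\<close>, \<open>chans\<close>, \<open>coup\<close> and \<open>feed\<close> describe the external channels only.
  The interconnection channels are described by the remaining fields; their feedthrough is the
  identity.\<close>

record field_model =
  fldA :: lqss
  fldB :: lqss
  links :: nat
  linkA :: "real mat"
  linkB :: "real mat"
  scat :: "real mat"

definition valid_field_model :: "field_model \<Rightarrow> bool" where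
  "valid_field_model F \<longleftrightarrow> valid_lqss (fldA F) \<and> valid_lqss (fldB F)
     \<and> linkA F \<in> carrier_mat (2 * links F) (2 * modes (fldA F))
     \<and> linkB F \<in> carrier_mat (2 * links F) (2 * modes (fldB F))
     \<and> symplectic (links F) (scat F)"

text \<open>\<open>XA\<close> and \<open>XB\<close> stand for \<open>x\<^sub>A dt\<close> and \<open>x\<^sub>B dt\<close>, \<open>UA\<close> and \<open>UB\<close> for the differentials of
  the external inputs. \<open>Other\<close> stands for an arbitrary further scalar differential, which occurs
  in neither model: the interconnection fields are solved for among expressions that may
  involve it, so that uniqueness of the solution is not vacuous when there are neither modes
  nor external channels.\<close>

datatype differential = XA | XB | UA | UB | Other

fun diff_dim :: "lqss \<Rightarrow> lqss \<Rightarrow> differential \<Rightarrow> nat" where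
  "diff_dim A B XA = 2 * modes A"
| "diff_dim A B XB = 2 * modes B"
| "diff_dim A B UA = 2 * chans A"
| "diff_dim A B UB = 2 * chans B"
| "diff_dim A B Other = 1"

text \<open>A vector-valued linear expression is given by its coefficient matrices, so that equality of
  expressions is equality of all the coefficient matrices.\<close>

type_synonym lin_expr = "differential \<Rightarrow> real mat"

definition carrier_expr :: "lqss \<Rightarrow> lqss \<Rightarrow> nat \<Rightarrow> lin_expr set" where
  "carrier_expr A B r = {e. \<forall>s. e s \<in> carrier_mat r (diff_dim A B s)}"

definition monomial :: "lqss \<Rightarrow> lqss \<Rightarrow> real mat \<Rightarrow> differential \<Rightarrow> lin_expr" where
  "monomial A B M s = (\<lambda>t. if t = s then M else 0\<^sub>m (dim_row M) (diff_dim A B t))"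

definition expr_add :: "lin_expr \<Rightarrow> lin_expr \<Rightarrow> lin_expr" (infixl "\<oplus>\<^sub>e" 65) where
  "e \<oplus>\<^sub>e f = (\<lambda>s. e s + f s)"

definition expr_mult :: "real mat \<Rightarrow> lin_expr \<Rightarrow> lin_expr" (infixr "\<odot>\<^sub>e" 70) where
  "M \<odot>\<^sub>e e = (\<lambda>s. M * e s)"

definition drift :: "lqss \<Rightarrow> real mat" where
  "drift S = JJ (modes S) * ham S - (1/2) \<cdot>\<^sub>m (sharp (coup S) * coup S)"

text \<open>Order of the components: \<open>dx\<^sub>A, dx\<^sub>B\<close>, then the external outputs of A and of B.\<close>

definition direct_dynamics ::
  "direct_model \<Rightarrow> lin_expr \<times> lin_expr \<times> lin_expr \<times> lin_expr" where
  "direct_dynamics M = (let A = dirA M; B = dirB M; mono = monomial A B in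
     (mono (drift A) XA \<oplus>\<^sub>e mono (JJ (modes A) * inter M) XB
        \<oplus>\<^sub>e mono (- (sharp (coup A) * feed A)) UA,
      mono (drift B) XB \<oplus>\<^sub>e mono (JJ (modes B) * transpose_mat (inter M)) XA
        \<oplus>\<^sub>e mono (- (sharp (coup B) * feed B)) UB,
      mono (coup A) XA \<oplus>\<^sub>e mono (feed A) UA,
      mono (coup B) XB \<oplus>\<^sub>e mono (feed B) UB))"

text \<open>Here \<open>u\<^sub>A\<close> and \<open>u\<^sub>B\<close> are expressions for the interconnection inputs.\<close>

definition field_dynamics ::
  "field_model \<Rightarrow> lin_expr \<Rightarrow> lin_expr \<Rightarrow> lin_expr \<times> lin_expr \<times> lin_expr \<times> lin_expr" where
  "field_dynamics F u\<^sub>A u\<^sub>B = (let A = fldA F; B = fldB F; mono = monomial A B in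
     (mono (drift A - (1/2) \<cdot>\<^sub>m (sharp (linkA F) * linkA F)) XA
        \<oplus>\<^sub>e mono (- (sharp (coup A) * feed A)) UA \<oplus>\<^sub>e (- sharp (linkA F)) \<odot>\<^sub>e u\<^sub>A,
      mono (drift B - (1/2) \<cdot>\<^sub>m (sharp (linkB F) * linkB F)) XB
        \<oplus>\<^sub>e mono (- (sharp (coup B) * feed B)) UB \<oplus>\<^sub>e (- sharp (linkB F)) \<odot>\<^sub>e u\<^sub>B,
      mono (coup A) XA \<oplus>\<^sub>e mono (feed A) UA,
      mono (coup B) XB \<oplus>\<^sub>e mono (feed B) UB))"

text \<open>The conditions \<open>U\<^sub>B = \<Sigma> Y\<^sub>A\<close> and \<open>U\<^sub>A = Y\<^sub>B\<close>, where \<open>dY\<^sub>A = C\<^sub>A x\<^sub>A dt + dU\<^sub>A\<close> and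
  \<open>dY\<^sub>B = C\<^sub>B x\<^sub>B dt + dU\<^sub>B\<close>.\<close>

definition interconnected :: "field_model \<Rightarrow> lin_expr \<Rightarrow> lin_expr \<Rightarrow> bool" where
  "interconnected F u\<^sub>A u\<^sub>B \<longleftrightarrow> (let A = fldA F; B = fldB F; r = 2 * links F in
     u\<^sub>A \<in> carrier_expr A B r \<and> u\<^sub>B \<in> carrier_expr A B r
     \<and> u\<^sub>B = scat F \<odot>\<^sub>e (monomial A B (linkA F) XA \<oplus>\<^sub>e u\<^sub>A)
     \<and> u\<^sub>A = monomial A B (linkB F) XB \<oplus>\<^sub>e u\<^sub>B)"

definition realized_by :: "direct_model \<Rightarrow> field_model \<Rightarrow> bool" where
  "realized_by M F \<longleftrightarrow>
     modes (fldA F) = modes (dirA M) \<and> chans (fldA F) = chans (dirA M)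
     \<and> modes (fldB F) = modes (dirB M) \<and> chans (fldB F) = chans (dirB M)
     \<and> valid_field_model F
     \<and> (\<exists>!(u\<^sub>A, u\<^sub>B). interconnected F u\<^sub>A u\<^sub>B)
     \<and> (\<forall>u\<^sub>A u\<^sub>B. interconnected F u\<^sub>A u\<^sub>B \<longrightarrow> field_dynamics F u\<^sub>A u\<^sub>B = direct_dynamics M)"

definition factorizes ::
  "nat \<Rightarrow> nat \<Rightarrow> real mat \<Rightarrow> nat \<Rightarrow> real mat \<Rightarrow> real mat \<Rightarrow> real mat \<Rightarrow> bool" where
  "factorizes n\<^sub>A n\<^sub>B R m C\<^sub>A C\<^sub>B X \<longleftrightarrow>
     C\<^sub>A \<in> carrier_mat (2 * m) (2 * n\<^sub>A) \<and> C\<^sub>B \<in> carrier_mat (2 * m) (2 * n\<^sub>B)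
     \<and> X \<in> carrier_mat (2 * m) (2 * m)
     \<and> sharp X = - X \<and> invertible_mat (X + 1\<^sub>m (2 * m))
     \<and> R = (1/2) \<cdot>\<^sub>m (JJ n\<^sub>A * sharp C\<^sub>A * (X + 1\<^sub>m (2 * m)) * C\<^sub>B)"

end

theory Submission
  imports Defs
begin

text \<open>Since \<open>JJ C\<^sup>\<sharp> = C\<^sup>T JJ\<close>, the choice \<open>X = 0\<close> reduces (i) to a factorization of \<open>Rb\<^sub>A\<^sub>B\<close> through
  a \<open>2m\<close>-dimensional space: if \<open>Rb\<^sub>A\<^sub>B = P Q\<close>, take \<open>C\<^sub>A = P\<^sup>T\<close> and \<open>C\<^sub>B = -2 JJ Q\<close>.

  For (ii), \<open>\<Sigma>\<close> is the Cayley transform of the \<open>\<sharp>\<close>-skew matrix \<open>X\<close>, hence symplectic, and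
  \<open>I - \<Sigma> = 2 (X + I)\<^sup>-\<^sup>1\<close> is invertible. Thus the loop equations have the unique solution
  \<open>U\<^sub>A = ((X + I) C\<^sub>B x\<^sub>B + (X - I) C\<^sub>A x\<^sub>A) / 2\<close>, \<open>U\<^sub>B = (X - I) (C\<^sub>B x\<^sub>B + C\<^sub>A x\<^sub>A) / 2\<close>.
  After substitution the cross terms give \<open>JJ Rb\<^sub>A\<^sub>B\<close> and, because \<open>(X + I)\<^sup>\<sharp> = -(X - I)\<close>, also
  \<open>JJ Rb\<^sub>A\<^sub>B\<^sup>T\<close>. In the self terms \<open>-I\<close> cancels the damping \<open>C\<^sup>\<sharp> C / 2\<close>, and the remaining
  \<open>C\<^sup>\<sharp> X C / 2\<close> is Hamiltonian and cancels the correction of the Hamiltonian matrix.\<close>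

section \<open>Calculus of \<open>JJ\<close> and the \<open>sharp\<close>-adjoint\<close>

lemma JJ_carrier [simp]: "JJ k \<in> carrier_mat (2 * k) (2 * k)"
  by (simp add: JJ_def mult_2)

lemma JJ_dims [simp]: "dim_row (JJ k) = 2 * k" "dim_col (JJ k) = 2 * k"
  using JJ_carrier[of k] by blast+

lemma JJ_mult_JJ: "JJ k * JJ k = - 1\<^sub>m (2 * k)"
  unfolding JJ_def
  by (subst mult_four_block_mat[of _ k k _ k _ k _ _ k _ k]) (auto simp: mult_2 intro!: eq_matI)

lemma transpose_JJ: "transpose_mat (JJ k) = - JJ k"
  unfolding JJ_def by (subst transpose_four_block_mat[of _ k k _ k _ k]) auto

lemma JJ_mult_JJ_mult:
  assumes "A \<in> carrier_mat (2 * k) n"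
  shows "JJ k * (JJ k * A) = - A"
proof -
  have "JJ k * (JJ k * A) = (JJ k * JJ k) * A"
    using assms by (intro assoc_mult_mat[symmetric]) auto
  then show ?thesis
    using assms by (simp add: JJ_mult_JJ)
qed

lemma sharp_eq:
  assumes "M \<in> carrier_mat (2 * r) (2 * s)"
  shows "sharp M = - (JJ s * transpose_mat M * JJ r)"
  using assms by (simp add: sharp_def)

lemma sharp_carrier [simp]:
  assumes "M \<in> carrier_mat (2 * r) (2 * s)"
  shows "sharp M \<in> carrier_mat (2 * s) (2 * r)"
  using assms by (auto simp: sharp_eq[OF assms] intro!: mult_carrier_mat)

lemma sharp_dims [simp]:
  "dim_row (sharp M) = 2 * (dim_col M div 2)" "dim_col (sharp M) = 2 * (dim_row M div 2)"
  by (simp_all add: sharp_def)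

text \<open>The two leading factors \<open>JJ s\<close> multiply to minus the identity, which
  absorbs the sign in \<open>sharp\<close>. Behind a factor \<open>JJ\<close>, the
  \<open>sharp\<close>-adjoint is thus a transpose, and its laws can be read off from those of
  transposition.\<close>

lemma JJ_mult_sharp:
  assumes M: "M \<in> carrier_mat (2 * r) (2 * s)"
  shows "JJ s * sharp M = transpose_mat M * JJ r"
proof -
  have "JJ s * sharp M = - (JJ s * (JJ s * (transpose_mat M * JJ r)))"
    using M by (simp add: sharp_eq[OF M] assoc_mult_mat[of _ "2 * s" "2 * s" _ "2 * r" _ "2 * r"])
  also have "\<dots> = transpose_mat M * JJ r"
    using M by (subst JJ_mult_JJ_mult) auto
  finally show ?thesis .
qed

lemma transpose_JJ_mult:
  assumes M: "M \<in> carrier_mat (2 * r) (2 * s)"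
  shows "transpose_mat (JJ r * M) = - (JJ s * sharp M)"
  using M by (simp add: JJ_mult_sharp[OF M] transpose_mult[of _ "2 * r" "2 * r" _ "2 * s"] transpose_JJ)

text \<open>Counterpart of \<open>JJ_mult_sharp\<close>: the laws of \<open>sharp\<close> below are
  proved after left multiplication by \<open>JJ\<close>, and this removes the extra factor
  again.\<close>

lemma JJ_mult_cancel:
  assumes "A \<in> carrier_mat (2 * k) n" "B \<in> carrier_mat (2 * k) n" "JJ k * A = JJ k * B"
  shows "A = B"
  using JJ_mult_JJ_mult[OF assms(1)] JJ_mult_JJ_mult[OF assms(2)] assms(3)
  by (metis uminus_eq_mat)

lemma sharp_mult:
  assumes A: "A \<in> carrier_mat (2 * r) (2 * s)" and B: "B \<in> carrier_mat (2 * s) (2 * t)"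
  shows "sharp (A * B) = sharp B * sharp A"
proof (rule JJ_mult_cancel)
  have "JJ t * (sharp B * sharp A) = (transpose_mat B * JJ s) * sharp A"
    using A B JJ_mult_sharp[OF B]
    by (metis JJ_carrier assoc_mult_mat sharp_carrier)
  also have "\<dots> = transpose_mat B * (transpose_mat A * JJ r)"
    using A B JJ_mult_sharp[OF A]
    by (metis JJ_carrier assoc_mult_mat sharp_carrier transpose_carrier_mat)
  also have "\<dots> = transpose_mat (A * B) * JJ r"
    using A B by (simp add: transpose_mult[OF A B] assoc_mult_mat[of _ "2 * t" "2 * s" _ "2 * r" _ "2 * r"])
  finally show "JJ t * sharp (A * B) = JJ t * (sharp B * sharp A)"
    using JJ_mult_sharp[of "A * B" r t] A B by simp
qed (use A B in \<open>auto intro!: sharp_carrier mult_carrier_mat\<close>)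

lemma sharp_add:
  assumes A: "A \<in> carrier_mat (2 * r) (2 * s)" and B: "B \<in> carrier_mat (2 * r) (2 * s)"
  shows "sharp (A + B) = sharp A + sharp B"
proof (rule JJ_mult_cancel)
  have "JJ s * sharp (A + B) = transpose_mat A * JJ r + transpose_mat B * JJ r"
    using A B
    by (simp add: JJ_mult_sharp[of _ r s] transpose_add[OF A B]
        add_mult_distrib_mat[of _ "2 * s" "2 * r" _ _ "2 * r"])
  also have "\<dots> = JJ s * (sharp A + sharp B)"
    using A B
    by (simp add: JJ_mult_sharp[of _ r s] mult_add_distrib_mat[of _ "2 * s" "2 * s" _ "2 * r"])
  finally show "JJ s * sharp (A + B) = JJ s * (sharp A + sharp B)" .
qed (use A B in \<open>auto intro!: sharp_carrier add_carrier_mat\<close>)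

lemma transpose_mat_smult: "transpose_mat (c \<cdot>\<^sub>m A) = c \<cdot>\<^sub>m transpose_mat A"
  by (auto intro!: eq_matI)

lemma sharp_smult:
  assumes A: "A \<in> carrier_mat (2 * r) (2 * s)"
  shows "sharp (c \<cdot>\<^sub>m A) = c \<cdot>\<^sub>m sharp A"
proof (rule JJ_mult_cancel)
  have "JJ s * sharp (c \<cdot>\<^sub>m A) = (c \<cdot>\<^sub>m transpose_mat A) * JJ r"
    using A by (simp add: JJ_mult_sharp[of _ r s] transpose_mat_smult)
  also have "\<dots> = JJ s * (c \<cdot>\<^sub>m sharp A)"
    using A
    by (simp add: JJ_mult_sharp[of _ r s] mult_smult_distrib[of _ "2 * s" "2 * s" _ "2 * r"]
        mult_smult_assoc_mat[of _ "2 * s" "2 * r" _ "2 * r"])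
  finally show "JJ s * sharp (c \<cdot>\<^sub>m A) = JJ s * (c \<cdot>\<^sub>m sharp A)" .
qed (use A in \<open>auto intro!: sharp_carrier smult_carrier_mat\<close>)

lemma sharp_uminus:
  assumes A: "A \<in> carrier_mat (2 * r) (2 * s)"
  shows "sharp (- A) = - sharp A"
proof -
  have neg: "- M = (- 1) \<cdot>\<^sub>m M" for M :: "real mat"
    by (auto intro!: eq_matI)
  show ?thesis
    using sharp_smult[OF A] by (simp add: neg)
qed

lemma sharp_sharp:
  assumes A: "A \<in> carrier_mat (2 * r) (2 * s)"
  shows "sharp (sharp A) = A"
proof (rule JJ_mult_cancel)
  have "JJ r * sharp (sharp A) = - transpose_mat (JJ s * sharp A)"
    using A by (subst transpose_JJ_mult[of _ s r]) auto
  also have "\<dots> = JJ r * A"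
    using A by (simp add: JJ_mult_sharp[OF A] transpose_mult[of _ "2 * s" "2 * r" _ "2 * r"] transpose_JJ)
  finally show "JJ r * sharp (sharp A) = JJ r * A" .
qed (use A in auto)

lemma sharp_one: "sharp (1\<^sub>m (2 * k)) = 1\<^sub>m (2 * k)"
  by (simp add: sharp_def JJ_mult_JJ)

text \<open>Transposing \<open>JJ k * M\<close> yields \<open>- (JJ k * sharp M)\<close>, so
  \<open>sharp\<close>-skew matrices correspond to Hamiltonian matrices. This is how the corrections
  of the Hamiltonian matrices are seen to be admissible.\<close>

lemma symmetric_JJ_mult:
  assumes M: "M \<in> carrier_mat (2 * k) (2 * k)" and "sharp M = - M"
  shows "symmetric (2 * k) (JJ k * M)"
  using M assms(2) by (auto simp: symmetric_def transpose_JJ_mult[OF M] intro!: mult_carrier_mat)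

section \<open>Factorization of a matrix through its rank\<close>

text \<open>A maximal independent set of columns has \<open>rank A\<close> elements and spans every
  column. Its vectors become the columns of \<open>P\<close>, and the coordinates of the columns of
  \<open>A\<close> become those of \<open>Q\<close>.\<close>

lemma (in vec_space) rank_factorization:
  assumes A: "A \<in> carrier_mat n nc" and k: "rank A \<le> k"
  obtains P Q where "P \<in> carrier_mat n k" "Q \<in> carrier_mat k nc" "A = P * Q"
proof -
  let ?C = "set (cols A)"
  have C: "?C \<subseteq> carrier_vec n"
    using A cols_dim by blast
  have "\<exists>S. finite S \<and> maximal S (\<lambda>T. T \<subseteq> ?C \<and> lin_indpt T) \<and> {} \<subseteq> S"
    by (rule maximal_exists_superset[of ?C]) (auto simp: lin_dep_def)
  then obtain S where "finite S" and S: "maximal S (\<lambda>T. T \<subseteq> ?C \<and> lin_indpt T)"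
    by blast
  have SC: "S \<subseteq> ?C" and ind: "lin_indpt S"
    using S by (auto simp: maximal_def)
  have span: "c \<in> span S" if c: "c \<in> ?C" for c
  proof (rule ccontr)
    assume notin: "c \<notin> span S"
    then have "c \<notin> S"
      using span_mem SC C by blast
    \<comment> \<open>A column outside the span could be adjoined without losing independence,
      against the maximality of \<open>S\<close>.\<close>
    then have "lin_indpt (S \<union> {c})"
      using lin_dep_iff_in_span[of S c] notin SC C ind c by blast
    with S c SC have "S \<union> {c} = S"
      unfolding maximal_def by blast
    with \<open>c \<notin> S\<close> show False by blast
  qed
  obtain ws where ws: "set ws = S" "distinct ws"
    using \<open>finite S\<close> finite_distinct_list by blast
  have len: "length ws \<le> k"
    using k rank_card_indpt[OF A S] distinct_card[OF ws(2)] ws(1) by simp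
  \<comment> \<open>\<open>P\<close> must have exactly \<open>k\<close> columns, while the rank may
    be smaller; zero vectors fill the gap and do no harm, since only
    \<open>S \<subseteq> set vs\<close> is needed for spanning.\<close>
  define vs where "vs = ws @ replicate (k - length ws) (0\<^sub>v n)"
  have vs: "set vs \<subseteq> carrier_vec n" "length vs = k" "S \<subseteq> set vs"
    using ws(1) SC C len by (auto simp: vs_def)
  define P where "P = mat_of_cols n vs"
  have P: "P \<in> carrier_mat n k"
    using vs(2) by (auto simp: P_def)
  have "\<exists>c. col A j = P *\<^sub>v vec k c" if "j < nc" for j
  proof -
    have "col A j \<in> ?C"
      using that A by (auto simp: cols_def)
    then have "col A j \<in> span (set vs)"
      using span span_is_monotone[OF vs(3)] by blast
    then obtain c where "col A j = lincomb_list c vs"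
      using in_span_listE span_list_as_span[OF vs(1)] by metis
    then show ?thesis
      using lincomb_list_as_mat_mult[of vs c] vs unfolding P_def by (metis carrier_vecD subsetD)
  qed
  then obtain c where c: "\<And>j. j < nc \<Longrightarrow> col A j = P *\<^sub>v vec k (c j)"
    by metis
  define Q where "Q = mat k nc (\<lambda>(i, j). c j i)"
  have Q: "Q \<in> carrier_mat k nc"
    by (simp add: Q_def)
  have "A = P * Q"
  proof (rule mat_col_eqI)
    fix j assume "j < dim_col (P * Q)"
    then have j: "j < nc"
      using Q by simp
    have "col Q j = vec k (c j)"
      using j by (auto simp: Q_def)
    then show "col A j = col (P * Q) j"
      using c[OF j] col_mult2[OF P Q j] by simp
  qed (use A P Q in auto)
  with P Q that show ?thesis by blast
qed

section \<open>Cayley transform and solution of the loop equations\<close>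

text \<open>With \<open>Y = X + I\<close> and \<open>Z = I - X\<close>, skewness makes
  \<open>sharp\<close> exchange \<open>Y\<close> and \<open>Z\<close>. For
  \<open>S = - Z * W\<close> this gives \<open>sharp S * S = V * Y * Z * W\<close> with
  \<open>V = sharp W\<close>; since \<open>Y\<close> and \<open>Z\<close> commute, it regroups to
  \<open>(V * Z) * (Y * W)\<close>, a product of identities.\<close>

lemma cayley_symplectic:
  assumes X: "X \<in> carrier_mat (2 * m) (2 * m)" and skew: "sharp X = - X"
    and W: "W \<in> carrier_mat (2 * m) (2 * m)"
    and YW: "(X + 1\<^sub>m (2 * m)) * W = 1\<^sub>m (2 * m)"
  shows "symplectic m ((X - 1\<^sub>m (2 * m)) * W)"
proof -
  let ?n = "2 * m"
  let ?I = "1\<^sub>m ?n"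
  define Y where "Y = X + ?I"
  define Z where "Z = - X + ?I"
  define V where "V = sharp W"
  have carr [simp]: "X \<in> carrier_mat ?n ?n" "W \<in> carrier_mat ?n ?n" "Y \<in> carrier_mat ?n ?n"
    "Z \<in> carrier_mat ?n ?n" "V \<in> carrier_mat ?n ?n"
    using X W by (auto simp: Y_def Z_def V_def)
  note assoc = assoc_mult_mat[of _ ?n ?n _ ?n _ ?n]
  note mult_carrier = mult_carrier_mat[of _ ?n ?n _ ?n]
  have sharp_Y: "sharp Y = Z"
    using X by (simp add: Y_def Z_def sharp_add[of _ m m] skew sharp_one)
  then have sharp_Z: "sharp Z = Y"
    using sharp_sharp[of Y m m] by simp
  have YW': "Y * W = ?I"
    using YW by (simp add: Y_def)
  have VZ: "V * Z = ?I"
    using arg_cong[OF YW', of sharp] sharp_mult[of Y m m W m] by (simp add: V_def sharp_Y sharp_one)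
  \<comment> \<open>Both products expand to \<open>I - X * X\<close>. Removing
    \<open>index_mult_mat(1)\<close> keeps entries of products as atoms, so that comparing entries
    is a linear problem; the same device recurs in later proofs.\<close>
  have YZ: "Y * Z = Z * Y"
    using X carrier_matD[OF X] unfolding Y_def Z_def
    by (simp add: add_mult_distrib_mat[of _ ?n ?n _ _ ?n] mult_add_distrib_mat[of _ ?n ?n _ ?n]
        left_mult_one_mat[of _ ?n ?n] right_mult_one_mat[of _ ?n ?n]
        uminus_mult_left_mat[of X X] uminus_mult_right_mat[of X X])
      (auto simp: mat_eq_iff simp del: index_mult_mat(1))
  let ?S = "- Z * W"
  have S_eq: "(X - ?I) * W = ?S"
    using X carrier_matD[OF X] unfolding Z_def
    by (intro arg_cong2[where f = "(*)"] eq_matI) auto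
  have S [simp]: "?S \<in> carrier_mat ?n ?n"
    by (simp add: mult_carrier)
  have sharp_S: "sharp ?S = - (V * Y)"
    using sharp_uminus[of "Z * W" m m] sharp_mult[of Z m m W m] carrier_matD[OF carr(2)] carrier_matD[OF carr(4)]
    by (simp add: V_def sharp_Z mult_carrier)
  have "sharp ?S * ?S = V * ((Y * Z) * W)"
    using carr(2-)[THEN carrier_matD(1)] carr(2-)[THEN carrier_matD(2)]
    unfolding sharp_S by (simp add: assoc mult_carrier)
  also have "\<dots> = (V * Z) * (Y * W)"
    unfolding YZ by (simp add: assoc mult_carrier)
  also have "\<dots> = ?I"
    by (simp add: VZ YW')
  finally have SS: "sharp ?S * ?S = ?I" .
  moreover have "?S * sharp ?S = ?I"
    by (rule mat_mult_left_right_inverse[OF _ S SS]) simp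
  ultimately show ?thesis
    unfolding S_eq symplectic_def by simp
qed

text \<open>Put \<open>Y = X + I\<close> and \<open>T = X - I\<close>. Multiplying the first
  equation by \<open>Y\<close>, which commutes with \<open>T\<close>, removes the inverse and leaves
  \<open>Y * v = T * (P + u)\<close>. Inserting \<open>u = Q + v\<close> and using
  \<open>Y - T = 2 I\<close> determines \<open>v\<close>. The matrices stand for the coefficients of
  one single differential of dimension \<open>d\<close>.\<close>

lemma loop_solution:
  fixes X W P Q u v :: "real mat"
  assumes X: "X \<in> carrier_mat n n" and W: "W \<in> carrier_mat n n"
    and P: "P \<in> carrier_mat n d" and Q: "Q \<in> carrier_mat n d"
    and u: "u \<in> carrier_mat n d" and v: "v \<in> carrier_mat n d"
    and YW: "(X + 1\<^sub>m n) * W = 1\<^sub>m n"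
  shows "v = ((X - 1\<^sub>m n) * W) * (P + u) \<and> u = Q + v
    \<longleftrightarrow> u = (1/2) \<cdot>\<^sub>m ((X + 1\<^sub>m n) * Q + (X - 1\<^sub>m n) * P)
      \<and> v = (1/2) \<cdot>\<^sub>m ((X - 1\<^sub>m n) * (Q + P))"
proof -
  define Y where "Y = X + 1\<^sub>m n"
  define T where "T = X - 1\<^sub>m n"
  have carr [simp]: "X \<in> carrier_mat n n" "W \<in> carrier_mat n n" "Y \<in> carrier_mat n n"
    "T \<in> carrier_mat n n" "P \<in> carrier_mat n d" "Q \<in> carrier_mat n d"
    "u \<in> carrier_mat n d" "v \<in> carrier_mat n d"
    using X W P Q u v by (auto simp: Y_def T_def)
  note assocn = assoc_mult_mat[of _ n n _ n _ n]
  note assocd = assoc_mult_mat[of _ n n _ n _ d]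
  note mult_carrier = mult_carrier_mat[of _ n n _ n] mult_carrier_mat[of _ n n _ d]
  note distribs = add_mult_distrib_mat[of _ n n _ _ n] mult_add_distrib_mat[of _ n n _ n]
    add_mult_distrib_mat[of _ n n _ _ d] mult_add_distrib_mat[of _ n n _ d]
    minus_mult_distrib_mat[of _ n n _ _ n] mult_minus_distrib_mat[of _ n n _ n]
    minus_mult_distrib_mat[of _ n n _ _ d] mult_minus_distrib_mat[of _ n n _ d]
    mult_smult_distrib[of _ n n _ d]
  note ones = left_mult_one_mat[of _ n n] right_mult_one_mat[of _ n n] left_mult_one_mat[of _ n d]
  have YW': "Y * W = 1\<^sub>m n"
    using YW by (simp add: Y_def)
  have WY: "W * Y = 1\<^sub>m n"
    by (rule mat_mult_left_right_inverse[OF _ _ YW']) auto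
  have YT: "Y * T = T * Y"
    unfolding Y_def T_def by (simp add: distribs ones)
  have "Y * (T * W) = T * (Y * W)"
    by (metis YT assocn carr(2-4))
  then have YS: "Y * (T * W) = T"
    by (simp add: YW' right_mult_one_mat[of _ n n])
  \<comment> \<open>An equivalence, because \<open>Y\<close> has the left inverse \<open>W\<close>:
    nothing is lost when the equation is multiplied by \<open>Y\<close>.\<close>
  have step: "v = (T * W) * (P + u) \<longleftrightarrow> Y * v = T * (P + u)"
  proof
    assume "v = (T * W) * (P + u)"
    then have "Y * v = (Y * (T * W)) * (P + u)"
      by (simp add: assocd mult_carrier)
    then show "Y * v = T * (P + u)"
      by (simp add: YS)
  next
    assume *: "Y * v = T * (P + u)"
    have "v = (W * Y) * v"
      by (simp add: WY ones)
    also have "\<dots> = W * ((Y * (T * W)) * (P + u))"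
      by (simp add: assocd YS *)
    also have "\<dots> = (W * Y) * ((T * W) * (P + u))"
      by (simp add: assocd mult_carrier)
    also have "\<dots> = (T * W) * (P + u)"
      by (simp add: WY mult_carrier ones)
    finally show "v = (T * W) * (P + u)" .
  qed
  have half: "a = b / 2" if "2 * a = b" for a b :: real
    using that by simp
  have "Y * v = T * (P + u) \<and> u = Q + v
      \<longleftrightarrow> u = (1/2) \<cdot>\<^sub>m (Y * Q + T * P) \<and> v = (1/2) \<cdot>\<^sub>m (T * (Q + P))"
    (is "?l \<longleftrightarrow> ?r")
  proof
    assume l: ?l
    then have uv: "u = Q + v" and "Y * v = T * (P + (Q + v))"
      by auto
    then have "X * v + v = X * P + (X * Q + X * v) - (P + (Q + v))"
      unfolding Y_def T_def by (simp add: distribs mult_carrier ones)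
    \<comment> \<open>The terms \<open>X * v\<close> on the two sides cancel, and the two remaining
      copies of \<open>v\<close> add up.\<close>
    then have twice: "2 * v $$ (i, j) = (X * P) $$ (i, j) - P $$ (i, j) + ((X * Q) $$ (i, j) - Q $$ (i, j))"
      if "i < n" "j < d" for i j
      using that X P Q v
      by (auto simp: mat_eq_iff simp del: index_mult_mat(1) dest!: spec[of _ i] spec[of _ j])
    have "v $$ (i, j) = ((X * P) $$ (i, j) - P $$ (i, j) + ((X * Q) $$ (i, j) - Q $$ (i, j))) / 2"
      if "i < n" "j < d" for i j
      by (rule half[OF twice[OF that]])
    then show ?r
      unfolding uv Y_def T_def
      using carrier_matD[OF X] carrier_matD[OF P] carrier_matD[OF Q] carrier_matD[OF v]
      by (auto simp: distribs mult_carrier ones mat_eq_iff field_simps simp del: index_mult_mat(1))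
  next
    assume r: ?r
    have QP: "Q + P \<in> carrier_mat n d"
      by simp
    \<comment> \<open>Uses \<open>T + 2 I = Y\<close>, which merges the added \<open>P\<close> into
      the \<open>P\<close>-part of \<open>u\<close>.\<close>
    have "P + (1/2) \<cdot>\<^sub>m (Y * Q + T * P) = (1/2) \<cdot>\<^sub>m (Y * (Q + P))"
      unfolding Y_def T_def
      using carrier_matD[OF X] carrier_matD[OF P] carrier_matD[OF Q]
      by (auto simp: distribs mult_carrier ones mat_eq_iff field_simps simp del: index_mult_mat(1))
    then have "T * (P + (1/2) \<cdot>\<^sub>m (Y * Q + T * P)) = (1/2) \<cdot>\<^sub>m ((T * Y) * (Q + P))"
      by (simp add: mult_smult_distrib[OF carr(4) mult_carrier_mat[OF carr(3) QP]] assocd[OF _ _ QP])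
    also have "\<dots> = Y * ((1/2) \<cdot>\<^sub>m (T * (Q + P)))"
      unfolding YT[symmetric]
      by (simp add: mult_smult_distrib[OF carr(3) mult_carrier_mat[OF carr(4) QP]] assocd[OF _ _ QP])
    finally have "Y * ((1/2) \<cdot>\<^sub>m (T * (Q + P))) = T * (P + (1/2) \<cdot>\<^sub>m (Y * Q + T * P))" ..
    moreover have "(1/2) \<cdot>\<^sub>m (Y * Q + T * P) = Q + (1/2) \<cdot>\<^sub>m (T * (Q + P))"
      unfolding Y_def T_def
      using carrier_matD[OF X] carrier_matD[OF P] carrier_matD[OF Q]
      by (auto simp: distribs mult_carrier ones mat_eq_iff field_simps simp del: index_mult_mat(1))
    ultimately show ?l
      using r by metis
  qed
  then show ?thesis
    using step unfolding Y_def T_def by simp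
qed

section \<open>Interaction terms and compensated Hamiltonians\<close>

text \<open>Here \<open>R = JJ nA * N\<close> with \<open>N = (1/2) sharp CA (X + I) CB\<close>, so
  \<open>JJ nA * R = - N\<close> and \<open>JJ nB * transpose_mat R = sharp N\<close>. Since
  \<open>sharp\<close> maps \<open>X + I\<close> to \<open>- (X - I)\<close>, the two results are
  the partner-state terms contributed by the inputs of A and of B.\<close>

lemma JJ_mult_interaction:
  fixes CA CB X :: "real mat" and nA nB m :: nat
  assumes CA: "CA \<in> carrier_mat (2 * m) (2 * nA)" and CB: "CB \<in> carrier_mat (2 * m) (2 * nB)"
    and X: "X \<in> carrier_mat (2 * m) (2 * m)" and skew: "sharp X = - X"
  defines "R \<equiv> (1/2) \<cdot>\<^sub>m (JJ nA * sharp CA * (X + 1\<^sub>m (2 * m)) * CB)"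
  shows "JJ nA * R = - ((1/2) \<cdot>\<^sub>m (sharp CA * ((X + 1\<^sub>m (2 * m)) * CB)))"
    and "JJ nB * transpose_mat R = - ((1/2) \<cdot>\<^sub>m (sharp CB * ((X - 1\<^sub>m (2 * m)) * CA)))"
proof -
  let ?Y = "X + 1\<^sub>m (2 * m)"
  let ?T = "X - 1\<^sub>m (2 * m)"
  define N where "N = (1/2) \<cdot>\<^sub>m (sharp CA * (?Y * CB))"
  have sCA: "sharp CA \<in> carrier_mat (2 * nA) (2 * m)" and sCB: "sharp CB \<in> carrier_mat (2 * nB) (2 * m)"
    using CA CB by auto
  have Y: "?Y \<in> carrier_mat (2 * m) (2 * m)" and T: "?T \<in> carrier_mat (2 * m) (2 * m)"
    using X by auto
  have YC: "?Y * CB \<in> carrier_mat (2 * m) (2 * nB)" and TC: "?T * CA \<in> carrier_mat (2 * m) (2 * nA)"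
    using X CA CB by (auto intro!: mult_carrier_mat)
  have CYC: "sharp CA * (?Y * CB) \<in> carrier_mat (2 * nA) (2 * nB)"
    using sCA YC by (rule mult_carrier_mat)
  then have N: "N \<in> carrier_mat (2 * nA) (2 * nB)"
    by (simp add: N_def)
  have R: "R = JJ nA * N"
  proof -
    have "JJ nA * sharp CA * ?Y * CB = JJ nA * (sharp CA * (?Y * CB))"
      using sCA Y CB YC by (simp add: assoc_mult_mat[of _ "2 * nA" "2 * nA" _ "2 * m"]
          assoc_mult_mat[of _ "2 * nA" "2 * m" _ "2 * m" _ "2 * nB"]
          mult_carrier_mat[of _ "2 * nA" "2 * nA" _ "2 * m"])
    then show ?thesis
      using CYC by (simp add: R_def N_def mult_smult_distrib[of _ "2 * nA" "2 * nA" _ "2 * nB"])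
  qed
  show "JJ nA * R = - ((1/2) \<cdot>\<^sub>m (sharp CA * (?Y * CB)))"
    unfolding R using JJ_mult_JJ_mult[OF N] by (simp add: N_def)
  have "JJ nB * transpose_mat R = sharp N"
    using JJ_mult_JJ_mult[of "sharp N" nB "2 * nA"] N by (simp add: R transpose_JJ_mult[OF N])
  also have "\<dots> = (1/2) \<cdot>\<^sub>m (sharp CB * (- ?T * CA))"
  proof -
    have sY: "sharp ?Y = - ?T"
      using X by (simp add: sharp_add[of _ m m] skew sharp_one) auto
    have "sharp (sharp CA * (?Y * CB)) = sharp (?Y * CB) * CA"
      using sharp_mult[OF sCA YC] by (simp add: sharp_sharp[OF CA])
    also have "\<dots> = (sharp CB * - ?T) * CA"
      using sharp_mult[OF Y CB] by (simp only: sY)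
    also have "\<dots> = sharp CB * (- ?T * CA)"
      by (rule assoc_mult_mat[OF sCB _ CA]) (use T in simp)
    finally show ?thesis
      unfolding N_def sharp_smult[OF CYC] by simp
  qed
  also have "\<dots> = - ((1/2) \<cdot>\<^sub>m (sharp CB * (?T * CA)))"
    using sCB T CA TC by (auto simp: uminus_mult_left_mat[of ?T CA] uminus_mult_right_mat[of "sharp CB" "?T * CA"] intro!: eq_matI simp del: index_mult_mat(1))
  finally show "JJ nB * transpose_mat R = - ((1/2) \<cdot>\<^sub>m (sharp CB * (?T * CA)))" .
qed

text \<open>Common form of the Hamiltonian matrices \<open>R_A\<close> and \<open>R_B\<close> of the
  field model. The subtracted term offsets the Hamiltonian self-interaction created by the
  loop.\<close>

definition compensated_ham :: "nat \<Rightarrow> real mat \<Rightarrow> real mat \<Rightarrow> real mat \<Rightarrow> real mat" where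
  "compensated_ham n R C X = R - (1/2) \<cdot>\<^sub>m (JJ n * (sharp C * X * C))"

lemma sharp_congruence_carrier:
  assumes C: "C \<in> carrier_mat (2 * m) (2 * n)" and X: "X \<in> carrier_mat (2 * m) (2 * m)"
  shows "sharp C * X * C \<in> carrier_mat (2 * n) (2 * n)"
  using C X by (auto intro!: mult_carrier_mat sharp_carrier)

text \<open>The congruence \<open>sharp C * X * C\<close> inherits \<open>sharp\<close>-skewness
  from \<open>X\<close>, so \<open>symmetric_JJ_mult\<close> applies to the correction.\<close>

lemma symmetric_compensated_ham:
  assumes R: "symmetric (2 * n) R" and C: "C \<in> carrier_mat (2 * m) (2 * n)"
    and X: "X \<in> carrier_mat (2 * m) (2 * m)" and skew: "sharp X = - X"
  shows "symmetric (2 * n) (compensated_ham n R C X)"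
proof -
  let ?M = "sharp C * X * C"
  have sC: "sharp C \<in> carrier_mat (2 * n) (2 * m)"
    using C by simp
  then have CX: "sharp C * X \<in> carrier_mat (2 * n) (2 * m)"
    using X by (rule mult_carrier_mat)
  have M: "?M \<in> carrier_mat (2 * n) (2 * n)"
    using CX C by (rule mult_carrier_mat)
  have "sharp ?M = sharp C * (- X * C)"
    unfolding sharp_mult[OF CX C] sharp_mult[OF sC X] sharp_sharp[OF C] skew ..
  also have "\<dots> = - ?M"
    using carrier_matD[OF sC] carrier_matD[OF X] C X by (simp add: uminus_mult_left_mat[of X C] uminus_mult_right_mat[of "sharp C" "X * C"] assoc_mult_mat[OF sC X C])
  finally have S: "symmetric (2 * n) (JJ n * ?M)"
    by (rule symmetric_JJ_mult[OF M])
  show ?thesis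
    using R S unfolding symmetric_def compensated_ham_def
    by (auto simp: transpose_minus[of _ "2 * n" "2 * n"] transpose_mat_smult
        intro!: minus_carrier_mat smult_carrier_mat)
qed

text \<open>The compensation contributes \<open>(1/2) sharp C X C\<close> to the drift. The loop
  contributes the negative of this plus \<open>(1/2) sharp C C\<close>, which cancels the damping of
  the interconnection channels. \<open>K\<close> carries along the damping of the external
  channels.\<close>

lemma drift_compensated:
  fixes C X R K :: "real mat"
  assumes R: "R \<in> carrier_mat (2 * n) (2 * n)" and C: "C \<in> carrier_mat (2 * m) (2 * n)"
    and X: "X \<in> carrier_mat (2 * m) (2 * m)" and K: "K \<in> carrier_mat (2 * n) (2 * n)"
  shows "JJ n * compensated_ham n R C X - K - (1/2) \<cdot>\<^sub>m (sharp C * C)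
      - (1/2) \<cdot>\<^sub>m (sharp C * ((X - 1\<^sub>m (2 * m)) * C)) = JJ n * R - K"
proof -
  let ?M = "sharp C * X * C"
  have sC: "sharp C \<in> carrier_mat (2 * n) (2 * m)"
    using C by simp
  have M: "?M \<in> carrier_mat (2 * n) (2 * n)"
    using C X by (rule sharp_congruence_carrier)
  have CC: "sharp C * C \<in> carrier_mat (2 * n) (2 * n)"
    using sC C by (rule mult_carrier_mat)
  have JM: "JJ n * ?M \<in> carrier_mat (2 * n) (2 * n)" and JR: "JJ n * R \<in> carrier_mat (2 * n) (2 * n)"
    using mult_carrier_mat[OF JJ_carrier M] mult_carrier_mat[OF JJ_carrier R] by simp_all
  have 1: "JJ n * compensated_ham n R C X = JJ n * R + (1/2) \<cdot>\<^sub>m ?M"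
    unfolding compensated_ham_def
    using R M JM JJ_mult_JJ_mult[OF M] JR
    by (simp add: mult_minus_distrib_mat[of _ "2 * n" "2 * n" _ "2 * n"]
        mult_smult_distrib[of _ "2 * n" "2 * n" _ "2 * n"]) (auto intro!: eq_matI simp del: index_mult_mat(1))
  have "(X - 1\<^sub>m (2 * m)) * C = X * C - C"
    using X C by (simp add: minus_mult_distrib_mat[of _ "2 * m" "2 * m" _ _ "2 * n"])
  then have 2: "sharp C * ((X - 1\<^sub>m (2 * m)) * C) = ?M - sharp C * C"
    using sC X C by (simp add: mult_minus_distrib_mat[of _ "2 * n" "2 * m" _ "2 * n"]
        mult_carrier_mat[of _ "2 * m" "2 * m" _ "2 * n"] assoc_mult_mat[OF sC X C])
  show ?thesis
    unfolding 1 2 using M JR CC K R C X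
    by (auto intro!: eq_matI simp: diff_divide_distrib simp del: index_mult_mat(1))
qed

section \<open>Interconnection inputs and the closed-loop dynamics\<close>

text \<open>Solution for the input of A, taken from \<open>loop_solution\<close> at each
  differential \<open>s\<close>: the monomial of \<open>CA\<close> plays the role of
  \<open>P\<close>, that of \<open>CB\<close> the role of \<open>Q\<close>.\<close>

definition link_input_A :: "lqss \<Rightarrow> lqss \<Rightarrow> real mat \<Rightarrow> real mat \<Rightarrow> nat \<Rightarrow> real mat \<Rightarrow> lin_expr" where
  "link_input_A A B CA CB m X = (\<lambda>s. (1/2) \<cdot>\<^sub>m ((X + 1\<^sub>m (2 * m)) * monomial A B CB XB s
     + (X - 1\<^sub>m (2 * m)) * monomial A B CA XA s))"

definition link_input_B :: "lqss \<Rightarrow> lqss \<Rightarrow> real mat \<Rightarrow> real mat \<Rightarrow> nat \<Rightarrow> real mat \<Rightarrow> lin_expr" where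
  "link_input_B A B CA CB m X = (\<lambda>s. (1/2) \<cdot>\<^sub>m ((X - 1\<^sub>m (2 * m))
     * (monomial A B CB XB s + monomial A B CA XA s)))"

lemma monomial_carrier:
  assumes "M \<in> carrier_mat r (diff_dim A B s)"
  shows "monomial A B M s t \<in> carrier_mat r (diff_dim A B t)"
  using assms by (auto simp: monomial_def)

text \<open>Equality of expressions is equality at each differential, so
  \<open>loop_solution\<close> applies pointwise with \<open>diff_dim A B s\<close> columns.\<close>

lemma interconnected_iff:
  fixes X :: "real mat"
  assumes X: "X \<in> carrier_mat (2 * m) (2 * m)" and W: "W \<in> carrier_mat (2 * m) (2 * m)"
    and YW: "(X + 1\<^sub>m (2 * m)) * W = 1\<^sub>m (2 * m)"
    and CA: "CA \<in> carrier_mat (2 * m) (2 * modes A)" and CB: "CB \<in> carrier_mat (2 * m) (2 * modes B)"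
  shows "interconnected \<lparr> fldA = A, fldB = B, links = m, linkA = CA, linkB = CB,
        scat = (X - 1\<^sub>m (2 * m)) * W \<rparr> uA uB
      \<longleftrightarrow> uA = link_input_A A B CA CB m X \<and> uB = link_input_B A B CA CB m X"
proof -
  let ?P = "monomial A B CA XA" and ?Q = "monomial A B CB XB"
  let ?uA = "link_input_A A B CA CB m X" and ?uB = "link_input_B A B CA CB m X"
  have P: "?P s \<in> carrier_mat (2 * m) (diff_dim A B s)" for s
    using CA by (intro monomial_carrier) simp
  have Q: "?Q s \<in> carrier_mat (2 * m) (diff_dim A B s)" for s
    using CB by (intro monomial_carrier) simp
  have T: "X - 1\<^sub>m (2 * m) \<in> carrier_mat (2 * m) (2 * m)" and Y: "X + 1\<^sub>m (2 * m) \<in> carrier_mat (2 * m) (2 * m)"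
    using X by auto
  \<comment> \<open>Needed for the direction from right to left: \<open>interconnected\<close> also
    demands that the inputs be well-dimensioned expressions.\<close>
  have carr: "?uA \<in> carrier_expr A B (2 * m)" "?uB \<in> carrier_expr A B (2 * m)"
    unfolding carrier_expr_def link_input_A_def link_input_B_def mem_Collect_eq
    by (intro allI smult_carrier_mat add_carrier_mat mult_carrier_mat[OF T] P)+
  have *: "uB = ((X - 1\<^sub>m (2 * m)) * W) \<odot>\<^sub>e (?P \<oplus>\<^sub>e uA) \<and> uA = ?Q \<oplus>\<^sub>e uB
      \<longleftrightarrow> uA = ?uA \<and> uB = ?uB"
    if uA: "uA \<in> carrier_expr A B (2 * m)" and uB: "uB \<in> carrier_expr A B (2 * m)" for uA uB
  proof -
    have "uB s = ((X - 1\<^sub>m (2 * m)) * W) * (?P s + uA s) \<and> uA s = ?Q s + uB s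
        \<longleftrightarrow> uA s = ?uA s \<and> uB s = ?uB s" for s
      unfolding link_input_A_def link_input_B_def
      using uA uB by (intro loop_solution[OF X W P Q _ _ YW]) (auto simp: carrier_expr_def)
    then show ?thesis
      unfolding fun_eq_iff expr_add_def expr_mult_def all_conj_distrib[symmetric] by (simp only:)
  qed
  show ?thesis
    unfolding interconnected_def Let_def field_model.simps using *[of uA uB] carr by metis
qed

text \<open>The state equation of a feedback model, with own state \<open>s\<close>, partner state \<open>t\<close> and external
  input \<open>w\<close>. The field case and the direct case list their summands in different orders.\<close>

lemma feedback_expr_eq:
  assumes E: "E \<in> carrier_mat r (diff_dim A B s)" and E': "E' \<in> carrier_mat r (diff_dim A B s)"
    and N: "N \<in> carrier_mat r (diff_dim A B t)" and G: "G \<in> carrier_mat r (diff_dim A B w)"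
    and distinct: "s \<noteq> t" "w \<noteq> s" "w \<noteq> t"
    and s: "E + M * u s = E'" and t: "M * u t = N"
    and other: "\<And>x. x \<noteq> s \<Longrightarrow> x \<noteq> t \<Longrightarrow> M * u x = 0\<^sub>m r (diff_dim A B x)"
  shows "monomial A B E s \<oplus>\<^sub>e monomial A B G w \<oplus>\<^sub>e M \<odot>\<^sub>e u
    = monomial A B E' s \<oplus>\<^sub>e monomial A B N t \<oplus>\<^sub>e monomial A B G w"
proof
  fix x
  consider "x = s" | "x = t" | "x = w" | "x \<noteq> s" "x \<noteq> t" "x \<noteq> w"
    by blast
  then show "(monomial A B E s \<oplus>\<^sub>e monomial A B G w \<oplus>\<^sub>e M \<odot>\<^sub>e u) x
    = (monomial A B E' s \<oplus>\<^sub>e monomial A B N t \<oplus>\<^sub>e monomial A B G w) x"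
    using E E' N G distinct s t other[of x]
    by cases (auto simp: expr_add_def expr_mult_def monomial_def)
qed

text \<open>Both state equations have the shape of \<open>feedback_expr_eq\<close>:
  \<open>drift_compensated\<close> supplies the own-state coefficient,
  \<open>JJ_mult_interaction\<close> the partner-state coefficient, and all other coefficients of
  the interconnection inputs vanish.\<close>

lemma field_dynamics_solution:
  fixes RA RB KA KB DA DB CA CB X S :: "real mat" and nA nB mA mB m :: nat
  assumes RA: "RA \<in> carrier_mat (2 * nA) (2 * nA)" and RB: "RB \<in> carrier_mat (2 * nB) (2 * nB)"
    and KA: "KA \<in> carrier_mat (2 * mA) (2 * nA)" and KB: "KB \<in> carrier_mat (2 * mB) (2 * nB)"
    and DA: "DA \<in> carrier_mat (2 * mA) (2 * mA)" and DB: "DB \<in> carrier_mat (2 * mB) (2 * mB)"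
    and CA: "CA \<in> carrier_mat (2 * m) (2 * nA)" and CB: "CB \<in> carrier_mat (2 * m) (2 * nB)"
    and X: "X \<in> carrier_mat (2 * m) (2 * m)" and skew: "sharp X = - X"
  defines "A \<equiv> \<lparr> modes = nA, chans = mA, ham = compensated_ham nA RA CA X, coup = KA, feed = DA \<rparr>"
    and "B \<equiv> \<lparr> modes = nB, chans = mB, ham = compensated_ham nB RB CB X, coup = KB, feed = DB \<rparr>"
  shows "field_dynamics \<lparr> fldA = A, fldB = B, links = m, linkA = CA, linkB = CB, scat = S \<rparr>
        (link_input_A A B CA CB m X) (link_input_B A B CA CB m X)
      = direct_dynamics \<lparr> dirA = \<lparr> modes = nA, chans = mA, ham = RA, coup = KA, feed = DA \<rparr>,
          dirB = \<lparr> modes = nB, chans = mB, ham = RB, coup = KB, feed = DB \<rparr>,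
          inter = (1/2) \<cdot>\<^sub>m (JJ nA * sharp CA * (X + 1\<^sub>m (2 * m)) * CB) \<rparr>"
proof -
  let ?Y = "X + 1\<^sub>m (2 * m)" and ?T = "X - 1\<^sub>m (2 * m)"
  let ?R = "(1/2) \<cdot>\<^sub>m (JJ nA * sharp CA * ?Y * CB)"
  let ?uA = "link_input_A A B CA CB m X" and ?uB = "link_input_B A B CA CB m X"
  have sCA: "sharp CA \<in> carrier_mat (2 * nA) (2 * m)" and sCB: "sharp CB \<in> carrier_mat (2 * nB) (2 * m)"
    using CA CB by auto
  have Y: "?Y \<in> carrier_mat (2 * m) (2 * m)" and T: "?T \<in> carrier_mat (2 * m) (2 * m)"
    using X by auto
  note YCB = mult_carrier_mat[OF Y CB] and TCA = mult_carrier_mat[OF T CA]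
    and TCB = mult_carrier_mat[OF T CB]
  have uA: "?uA XA = (1/2) \<cdot>\<^sub>m (?T * CA)" "?uA XB = (1/2) \<cdot>\<^sub>m (?Y * CB)"
    "?uA UA = 0\<^sub>m (2 * m) (2 * mA)" "?uA UB = 0\<^sub>m (2 * m) (2 * mB)" "?uA Other = 0\<^sub>m (2 * m) 1"
    and uB: "?uB XA = (1/2) \<cdot>\<^sub>m (?T * CA)" "?uB XB = (1/2) \<cdot>\<^sub>m (?T * CB)"
    "?uB UA = 0\<^sub>m (2 * m) (2 * mA)" "?uB UB = 0\<^sub>m (2 * m) (2 * mB)" "?uB Other = 0\<^sub>m (2 * m) 1"
    using X CA CB Y T YCB TCA TCB
    by (auto simp: link_input_A_def link_input_B_def monomial_def A_def B_def)
  have neg_smult: "- sharp C * ((1/2) \<cdot>\<^sub>m M) = - ((1/2) \<cdot>\<^sub>m (sharp C * M))"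
    if "sharp C \<in> carrier_mat k (2 * m)" "M \<in> carrier_mat (2 * m) d" for C M k d
    using that carrier_matD[OF that(1)] carrier_matD[OF that(2)]
    by (simp add: mult_smult_distrib[OF that])
  note inter = JJ_mult_interaction[OF CA CB X skew]
  have dim_drift: "drift \<lparr> modes = n, chans = k, ham = R, coup = K, feed = D \<rparr> \<in> carrier_mat (2 * n) (2 * n)"
    if "K \<in> carrier_mat (2 * k) (2 * n)" for n k R K D
    using mult_carrier_mat[OF sharp_carrier[OF that] that] by (auto simp: drift_def intro!: minus_carrier_mat smult_carrier_mat)
  have dims: "diff_dim A B XA = 2 * nA" "diff_dim A B XB = 2 * nB" "diff_dim A B UA = 2 * mA"
    "diff_dim A B UB = 2 * mB" "modes A = nA" "modes B = nB" "chans A = mA" "chans B = mB"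
    by (simp_all add: A_def B_def)
  define A0 where "A0 = \<lparr> modes = nA, chans = mA, ham = RA, coup = KA, feed = DA \<rparr>"
  define B0 where "B0 = \<lparr> modes = nB, chans = mB, ham = RB, coup = KB, feed = DB \<rparr>"
  \<comment> \<open>The systems of the two models differ only in their Hamiltonian matrices, which
    do not affect dimensions; hence monomials over either pair coincide.\<close>
  have "diff_dim A0 B0 s = diff_dim A B s" for s
    by (cases s) (simp_all add: A0_def B0_def A_def B_def)
  then have mono: "monomial A0 B0 = monomial A B"
    by (simp add: monomial_def fun_eq_iff)
  have KKA: "sharp KA * KA \<in> carrier_mat (2 * nA) (2 * nA)" and KKB: "sharp KB * KB \<in> carrier_mat (2 * nB) (2 * nB)"
    using KA KB by (auto intro!: mult_carrier_mat sharp_carrier)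
  have dA: "drift A - (1/2) \<cdot>\<^sub>m (sharp CA * CA) - (1/2) \<cdot>\<^sub>m (sharp CA * (?T * CA)) = drift A0"
    using drift_compensated[OF RA CA X smult_carrier_mat[OF KKA, of "1/2"]]
    unfolding drift_def A_def A0_def lqss.simps .
  have dB: "drift B - (1/2) \<cdot>\<^sub>m (sharp CB * CB) - (1/2) \<cdot>\<^sub>m (sharp CB * (?T * CB)) = drift B0"
    using drift_compensated[OF RB CB X smult_carrier_mat[OF KKB, of "1/2"]]
    unfolding drift_def B_def B0_def lqss.simps .
  have driftA0: "drift A0 \<in> carrier_mat (2 * nA) (2 * nA)" and driftB0: "drift B0 \<in> carrier_mat (2 * nB) (2 * nB)"
    unfolding A0_def B0_def using dim_drift KA KB by blast+
  \<comment> \<open>Bridges a difference in form: \<open>dA\<close> and \<open>dB\<close> subtract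
    the loop term, while \<open>field_dynamics\<close> adds a product with
    \<open>- sharp\<close>.\<close>
  have shift: "L + - H = L0" if "L - H = L0" "L \<in> carrier_mat r k" "H \<in> carrier_mat r k" for L L0 H :: "real mat" and r k
    using that add_uminus_minus_mat[OF that(2,3)] by simp
  have cA: "monomial A B (drift A - (1/2) \<cdot>\<^sub>m (sharp CA * CA)) XA
        \<oplus>\<^sub>e monomial A B (- (sharp KA * DA)) UA \<oplus>\<^sub>e (- sharp CA) \<odot>\<^sub>e ?uA
      = monomial A B (drift A0) XA \<oplus>\<^sub>e monomial A B (JJ nA * ?R) XB \<oplus>\<^sub>e monomial A B (- (sharp KA * DA)) UA"
  proof (rule feedback_expr_eq[where r = "2 * nA"])
    show "drift A - (1/2) \<cdot>\<^sub>m (sharp CA * CA) + - sharp CA * ?uA XA = drift A0"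
      unfolding uA neg_smult[OF sCA TCA]
      by (rule shift[OF dA minus_carrier_mat smult_carrier_mat[OF mult_carrier_mat[OF sCA TCA]]]) (use mult_carrier_mat[OF sCA CA] in simp)
    show "- sharp CA * ?uA XB = JJ nA * ?R"
      unfolding uA neg_smult[OF sCA YCB] inter(1) ..
    show "- sharp CA * ?uA x = 0\<^sub>m (2 * nA) (diff_dim A B x)" if "x \<noteq> XA" "x \<noteq> XB" for x
      using that by (cases x) (simp_all add: uA dims right_mult_zero_mat[OF uminus_carrier_mat[OF sCA]])
    show "drift A - (1/2) \<cdot>\<^sub>m (sharp CA * CA) \<in> carrier_mat (2 * nA) (diff_dim A B XA)"
      using mult_carrier_mat[OF sCA CA] by (auto simp: A_def intro!: minus_carrier_mat)
    show "drift A0 \<in> carrier_mat (2 * nA) (diff_dim A B XA)"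
      using driftA0 by (simp add: A_def)
    show "JJ nA * ?R \<in> carrier_mat (2 * nA) (diff_dim A B XB)"
      unfolding inter(1) using mult_carrier_mat[OF sCA YCB] by (simp add: B_def)
    show "- (sharp KA * DA) \<in> carrier_mat (2 * nA) (diff_dim A B UA)"
      using mult_carrier_mat[OF sharp_carrier[OF KA] DA] by (simp add: A_def)
  qed simp_all
  have cB: "monomial A B (drift B - (1/2) \<cdot>\<^sub>m (sharp CB * CB)) XB
        \<oplus>\<^sub>e monomial A B (- (sharp KB * DB)) UB \<oplus>\<^sub>e (- sharp CB) \<odot>\<^sub>e ?uB
      = monomial A B (drift B0) XB \<oplus>\<^sub>e monomial A B (JJ nB * transpose_mat ?R) XA
        \<oplus>\<^sub>e monomial A B (- (sharp KB * DB)) UB"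
  proof (rule feedback_expr_eq[where r = "2 * nB"])
    show "drift B - (1/2) \<cdot>\<^sub>m (sharp CB * CB) + - sharp CB * ?uB XB = drift B0"
      unfolding uB neg_smult[OF sCB TCB]
      by (rule shift[OF dB minus_carrier_mat smult_carrier_mat[OF mult_carrier_mat[OF sCB TCB]]]) (use mult_carrier_mat[OF sCB CB] in simp)
    show "- sharp CB * ?uB XA = JJ nB * transpose_mat ?R"
      unfolding uB neg_smult[OF sCB TCA] inter(2) ..
    show "- sharp CB * ?uB x = 0\<^sub>m (2 * nB) (diff_dim A B x)" if "x \<noteq> XB" "x \<noteq> XA" for x
      using that by (cases x) (simp_all add: uB dims right_mult_zero_mat[OF uminus_carrier_mat[OF sCB]])
    show "drift B - (1/2) \<cdot>\<^sub>m (sharp CB * CB) \<in> carrier_mat (2 * nB) (diff_dim A B XB)"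
      using mult_carrier_mat[OF sCB CB] by (auto simp: B_def intro!: minus_carrier_mat)
    show "drift B0 \<in> carrier_mat (2 * nB) (diff_dim A B XB)"
      using driftB0 by (simp add: B_def)
    show "JJ nB * transpose_mat ?R \<in> carrier_mat (2 * nB) (diff_dim A B XA)"
      unfolding inter(2) using mult_carrier_mat[OF sCB TCA] by (simp add: A_def)
    show "- (sharp KB * DB) \<in> carrier_mat (2 * nB) (diff_dim A B UB)"
      using mult_carrier_mat[OF sharp_carrier[OF KB] DB] by (simp add: B_def)
  qed simp_all
  have coup_feed: "coup A = KA" "feed A = DA" "coup B = KB" "feed B = DB" "modes A = nA" "modes B = nB"
    "coup A0 = KA" "feed A0 = DA" "coup B0 = KB" "feed B0 = DB" "modes A0 = nA" "modes B0 = nB"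
    by (simp_all add: A_def B_def A0_def B0_def)
  show ?thesis
    unfolding field_dynamics_def direct_dynamics_def Let_def direct_model.simps field_model.simps
      A0_def[symmetric] B0_def[symmetric] mono coup_feed cA cB ..
qed

section \<open>Existence of the factorization and realization\<close>

text \<open>Invertibility makes \<open>M\<close> a unit of the matrix ring, which rules out the
  result \<open>None\<close> of \<open>mat_inverse\<close>; so \<open>the\<close> in
  \<open>mat_inv\<close> returns an actual inverse.\<close>

lemma mat_inv_right_inverse:
  assumes M: "M \<in> carrier_mat n n" and "invertible_mat M"
  shows "M * mat_inv M = 1\<^sub>m n" "mat_inv M \<in> carrier_mat n n"
proof -
  obtain B where "inverts_mat M B" "inverts_mat B M"
    using assms(2) by (auto simp: invertible_mat_def)
  then have MB: "M * B = 1\<^sub>m n" and BM: "B * M = 1\<^sub>m (dim_row B)"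
    using M by (auto simp: inverts_mat_def)
  \<comment> \<open>\<open>inverts_mat\<close> does not fix the dimensions of \<open>B\<close>; they
    follow by comparing dimensions in the two product equations.\<close>
  have "dim_col B = n" "dim_row B = n"
    using arg_cong[OF MB, of dim_col] arg_cong[OF BM, of dim_col] M by auto
  then have "B \<in> carrier_mat n n" "B * M = 1\<^sub>m n"
    using BM by auto
  with MB M have "M \<in> Units (ring_mat TYPE(real) n ())"
    by (auto simp: Units_def ring_mat_def)
  then obtain W where "mat_inverse M = Some W"
    using mat_inverse(1)[OF M, of "()"] by (cases "mat_inverse M") auto
  then show "M * mat_inv M = 1\<^sub>m n" "mat_inv M \<in> carrier_mat n n"
    using mat_inverse(2)[OF M] by (auto simp: mat_inv_def)
qed

lemma factorizes_exists:
  assumes R: "R \<in> carrier_mat (2 * nA) (2 * nB)" and rank: "vec_space.rank (2 * nA) R \<le> 2 * m"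
  shows "\<exists>CA CB X. factorizes nA nB R m CA CB X"
proof -
  obtain P Q where P: "P \<in> carrier_mat (2 * nA) (2 * m)" and Q: "Q \<in> carrier_mat (2 * m) (2 * nB)"
    and R_eq: "R = P * Q"
    by (rule vec_space.rank_factorization[OF R rank])
  define CA where "CA = transpose_mat P"
  \<comment> \<open>The sign undoes \<open>JJ m * JJ m = - I\<close>, and the 2 undoes the factor
    1/2 in \<open>factorizes\<close>.\<close>
  define CB where "CB = (- 2) \<cdot>\<^sub>m (JJ m * Q)"
  define X :: "real mat" where "X = 0\<^sub>m (2 * m) (2 * m)"
  have JQ: "JJ m * Q \<in> carrier_mat (2 * m) (2 * nB)"
    using JJ_carrier Q by (rule mult_carrier_mat)
  have CA: "CA \<in> carrier_mat (2 * m) (2 * nA)" and CB: "CB \<in> carrier_mat (2 * m) (2 * nB)"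
    using P JQ by (simp_all add: CA_def CB_def)
  have PJ: "P * JJ m \<in> carrier_mat (2 * nA) (2 * m)"
    using P JJ_carrier by (rule mult_carrier_mat)
  have X: "X + 1\<^sub>m (2 * m) = 1\<^sub>m (2 * m)"
    by (simp add: X_def)
  have "JJ nA * sharp CA * (X + 1\<^sub>m (2 * m)) * CB = (P * JJ m) * CB"
    using PJ by (simp add: X JJ_mult_sharp[OF CA]) (simp add: CA_def)
  also have "\<dots> = (- 2) \<cdot>\<^sub>m (P * (JJ m * (JJ m * Q)))"
    unfolding CB_def mult_smult_distrib[OF PJ JQ] assoc_mult_mat[OF P JJ_carrier JQ] ..
  also have "\<dots> = 2 \<cdot>\<^sub>m R"
    using P Q R_eq by (simp add: JJ_mult_JJ_mult[OF Q]) auto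
  finally have "R = (1/2) \<cdot>\<^sub>m (JJ nA * sharp CA * (X + 1\<^sub>m (2 * m)) * CB)"
    by (auto intro!: eq_matI)
  moreover have "sharp X = - X"
    using sharp_smult[of X m m 0] by (auto simp: X_def sharp_def intro!: eq_matI)
  moreover have "invertible_mat (X + 1\<^sub>m (2 * m))"
    unfolding X by (auto simp: invertible_mat_def inverts_mat_def intro!: exI[of _ "1\<^sub>m (2 * m)"])
  ultimately have "factorizes nA nB R m CA CB X"
    using CA CB by (simp add: factorizes_def X_def)
  then show ?thesis by blast
qed

lemma factorizes_realized:
  assumes RA: "symmetric (2 * nA) RA" and RB: "symmetric (2 * nB) RB"
    and KA: "KA \<in> carrier_mat (2 * mA) (2 * nA)" and KB: "KB \<in> carrier_mat (2 * mB) (2 * nB)"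
    and DA: "symplectic mA DA" and DB: "symplectic mB DB"
    and fact: "factorizes nA nB R m CA CB X"
  shows "realized_by
      \<lparr> dirA = \<lparr> modes = nA, chans = mA, ham = RA, coup = KA, feed = DA \<rparr>,
        dirB = \<lparr> modes = nB, chans = mB, ham = RB, coup = KB, feed = DB \<rparr>, inter = R \<rparr>
      \<lparr> fldA = \<lparr> modes = nA, chans = mA, ham = compensated_ham nA RA CA X, coup = KA, feed = DA \<rparr>,
        fldB = \<lparr> modes = nB, chans = mB, ham = compensated_ham nB RB CB X, coup = KB, feed = DB \<rparr>,
        links = m, linkA = CA, linkB = CB,
        scat = (X - 1\<^sub>m (2 * m)) * mat_inv (X + 1\<^sub>m (2 * m)) \<rparr>"
    (is "realized_by ?D ?F")
proof -
  let ?A = "\<lparr> modes = nA, chans = mA, ham = compensated_ham nA RA CA X, coup = KA, feed = DA \<rparr>"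
  let ?B = "\<lparr> modes = nB, chans = mB, ham = compensated_ham nB RB CB X, coup = KB, feed = DB \<rparr>"
  let ?uA = "link_input_A ?A ?B CA CB m X" and ?uB = "link_input_B ?A ?B CA CB m X"
  have CA: "CA \<in> carrier_mat (2 * m) (2 * nA)" and CB: "CB \<in> carrier_mat (2 * m) (2 * nB)"
    and X: "X \<in> carrier_mat (2 * m) (2 * m)" and skew: "sharp X = - X"
    and inv: "invertible_mat (X + 1\<^sub>m (2 * m))"
    and R: "R = (1/2) \<cdot>\<^sub>m (JJ nA * sharp CA * (X + 1\<^sub>m (2 * m)) * CB)"
    using fact unfolding factorizes_def by blast+
  have Y: "X + 1\<^sub>m (2 * m) \<in> carrier_mat (2 * m) (2 * m)"
    using X by simp
  note W = mat_inv_right_inverse[OF Y inv]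
  have valid: "valid_field_model ?F"
    using symmetric_compensated_ham[OF RA CA X skew] symmetric_compensated_ham[OF RB CB X skew]
      KA KB DA DB CA CB cayley_symplectic[OF X skew W(2) W(1)]
    by (simp add: valid_field_model_def valid_lqss_def)
  \<comment> \<open>Yields unique solvability and also reduces the claim about all interconnected
    pairs to this one pair.\<close>
  have sol: "interconnected ?F uA uB \<longleftrightarrow> uA = ?uA \<and> uB = ?uB" for uA uB
    by (rule interconnected_iff[OF X W(2) W(1)]) (simp_all add: CA CB)
  have unique: "\<exists>!(uA, uB). interconnected ?F uA uB"
    unfolding sol by (rule ex1I[of _ "(?uA, ?uB)"]) auto
  have dyn: "field_dynamics ?F ?uA ?uB = direct_dynamics ?D"
    unfolding R using RA RB DA DB
    by (intro field_dynamics_solution KA KB CA CB X skew) (simp_all add: symmetric_def symplectic_def)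
  have "field_dynamics ?F uA uB = direct_dynamics ?D" if "interconnected ?F uA uB" for uA uB
    using that dyn unfolding sol by blast
  then show ?thesis
    unfolding realized_by_def using valid unique by simp
qed

theorem theorem1:
  fixes n\<^sub>A n\<^sub>B m\<^sub>A m\<^sub>B :: nat
    and Rb\<^sub>A Rb\<^sub>B Cb\<^sub>A Cb\<^sub>B Db\<^sub>A Db\<^sub>B Rb\<^sub>A\<^sub>B :: "real mat"
  assumes "symmetric (2 * n\<^sub>A) Rb\<^sub>A" and "symmetric (2 * n\<^sub>B) Rb\<^sub>B"
    and "Cb\<^sub>A \<in> carrier_mat (2 * m\<^sub>A) (2 * n\<^sub>A)" and "Cb\<^sub>B \<in> carrier_mat (2 * m\<^sub>B) (2 * n\<^sub>B)"
    and "symplectic m\<^sub>A Db\<^sub>A" and "symplectic m\<^sub>B Db\<^sub>B"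
    and "Rb\<^sub>A\<^sub>B \<in> carrier_mat (2 * n\<^sub>A) (2 * n\<^sub>B)"
  shows "\<forall>m. int m \<ge> \<lceil>real (vec_space.rank (2 * n\<^sub>A) Rb\<^sub>A\<^sub>B) / 2\<rceil> \<longrightarrow>
      (\<exists>C\<^sub>A C\<^sub>B X. factorizes n\<^sub>A n\<^sub>B Rb\<^sub>A\<^sub>B m C\<^sub>A C\<^sub>B X)
      \<and> (\<forall>C\<^sub>A C\<^sub>B X. factorizes n\<^sub>A n\<^sub>B Rb\<^sub>A\<^sub>B m C\<^sub>A C\<^sub>B X \<longrightarrow>
          realized_by
            \<lparr> dirA = \<lparr> modes = n\<^sub>A, chans = m\<^sub>A, ham = Rb\<^sub>A, coup = Cb\<^sub>A, feed = Db\<^sub>A \<rparr>,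
              dirB = \<lparr> modes = n\<^sub>B, chans = m\<^sub>B, ham = Rb\<^sub>B, coup = Cb\<^sub>B, feed = Db\<^sub>B \<rparr>,
              inter = Rb\<^sub>A\<^sub>B \<rparr>
            \<lparr> fldA = \<lparr> modes = n\<^sub>A, chans = m\<^sub>A,
                ham = Rb\<^sub>A - (1/2) \<cdot>\<^sub>m (JJ n\<^sub>A * (sharp C\<^sub>A * X * C\<^sub>A)),
                coup = Cb\<^sub>A, feed = Db\<^sub>A \<rparr>,
              fldB = \<lparr> modes = n\<^sub>B, chans = m\<^sub>B,
                ham = Rb\<^sub>B - (1/2) \<cdot>\<^sub>m (JJ n\<^sub>B * (sharp C\<^sub>B * X * C\<^sub>B)),
                coup = Cb\<^sub>B, feed = Db\<^sub>B \<rparr>,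
              links = m, linkA = C\<^sub>A, linkB = C\<^sub>B,
              scat = (X - 1\<^sub>m (2 * m)) * mat_inv (X + 1\<^sub>m (2 * m)) \<rparr>)"
proof (intro allI impI conjI)
  fix m :: nat
  assume "\<lceil>real (vec_space.rank (2 * n\<^sub>A) Rb\<^sub>A\<^sub>B) / 2\<rceil> \<le> int m"
  then have "vec_space.rank (2 * n\<^sub>A) Rb\<^sub>A\<^sub>B \<le> 2 * m"
    \<comment> \<open>As \<open>m\<close> is an integer, the bound on the ceiling is the bound on
      half the rank itself.\<close>
    by (simp add: ceiling_le_iff)
  then show "\<exists>C\<^sub>A C\<^sub>B X. factorizes n\<^sub>A n\<^sub>B Rb\<^sub>A\<^sub>B m C\<^sub>A C\<^sub>B X"
    by (rule factorizes_exists[OF assms(7)])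
qed (rule factorizes_realized[OF assms(1-6), unfolded compensated_ham_def])

end
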